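(* Let $q$ be a positive integer and let $H_q$ be the $q$-dimensional complex Hilbert space of formal Dirichlet series $\sum_{n\ge1} a_n n^{-s}$ with $q$-periodic complex coefficient sequences $a=(a_n)_{n\ge1}$, equipped with the scalar product $$\Big\langle \sum_{n\ge 1} a_n n^{-s}, \sum_{n\ge 1} b_n n^{-s}\Big\rangle = \sum_{n=1}^q a_n\overline{b_n}.$$ Then: (i) The functions $L_\chi(s)/d^s$, where $d$ runs through the positive divisors of $q$ and $\chi$ runs through the Dirichlet characters modulo $q/d$, form an orthogonal basis of $H_q$. (ii) Let $\mathcal{D}_q^{\mathrm{pr}}$ be the set of primitive Dirichlet characters that induce the Dirichlet characters modulo $q$ (equivalently, the primitive characters whose conductor divides $q$). For $\psi\in\mathcal{D}_q^{\mathrm{pr}}$ let $E_{q,\psi}$ be the subspace of $H_q$ spanned by the functions $L_\psi(s)/d^s$, where $d$ runs through the positive divisors of $q/\mathrm{conductor}(\psi)$. Then $H_q$ is the orthogonal direct sum $$H_q=\bigoplus_{\psi\in\mathcal{D}_q^{\mathrm{pr}}} E_{q,\psi}.$$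
   Context: For a Dirichlet character $\chi$ modulo $m$, $L_\chi(s)=\sum_{n\ge1}\chi(n)n^{-s}$; the function $L_\chi(s)/d^s$ is identified with the Dirichlet series $\sum_{n\ge1}\chi(n/d)n^{-s}$, with the convention $\chi(t)=0$ if $t$ is not a positive integer; when $dm$ divides $q$ its coefficient sequence is $q$-periodic, so it is an element of $H_q$. *)

theory Defs
  imports Complex_Main "HOL-Library.FuncSet"
begin

section \<open>Formal Dirichlet series\<close>

text \<open>
  A formal Dirichlet series with complex coefficients is given by its coefficient sequence
  indexed by the positive integers; the junk index 0 always carries the value 0.
\<close>

typedef dseries = "{a :: nat \<Rightarrow> complex. a 0 = 0}"
  morphisms coeff Abs_dseries
  by (rule exI[of _ "\<lambda>_. 0"]) simp

setup_lifting type_definition_dseries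

lift_definition dseries_of :: "(nat \<Rightarrow> complex) \<Rightarrow> dseries" is
  "\<lambda>a n. if n = 0 then 0 else a n"
  by simp

instantiation dseries :: ab_group_add
begin

lift_definition zero_dseries :: dseries is "\<lambda>_. 0" by simp
lift_definition plus_dseries :: "dseries \<Rightarrow> dseries \<Rightarrow> dseries" is "\<lambda>a b n. a n + b n" by simp
lift_definition minus_dseries :: "dseries \<Rightarrow> dseries \<Rightarrow> dseries" is "\<lambda>a b n. a n - b n" by simp
lift_definition uminus_dseries :: "dseries \<Rightarrow> dseries" is "\<lambda>a n. - a n" by simp

instance
  by standard (transfer; auto)+

end

lift_definition cscale :: "complex \<Rightarrow> dseries \<Rightarrow> dseries" is "\<lambda>c a n. c * a n" by simp

interpretation dseries: vector_space cscale
  by standard (transfer; auto simp: algebra_simps)+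

text \<open>
  Division by \<open>d\<^sup>s\<close>: the coefficient of \<open>n\<^sup>-\<^sup>s\<close> in \<open>F(s)/d\<^sup>s\<close> is the coefficient of index \<open>n/d\<close> of \<open>F\<close>
  if \<open>n/d\<close> is a positive integer, and 0 otherwise.
\<close>

lift_definition divide_pow :: "dseries \<Rightarrow> nat \<Rightarrow> dseries" is
  "\<lambda>a d n. if n > 0 \<and> d dvd n then a (n div d) else 0"
  by simp

lemma coeff_0 [simp]: "coeff F 0 = 0"
  by transfer simp

lemma coeff_dseries_of: "coeff (dseries_of a) n = (if n = 0 then 0 else a n)"
  by transfer simp

lemma coeff_zero [simp]: "coeff 0 n = 0"
  by transfer simp

lemma coeff_add [simp]: "coeff (F + G) n = coeff F n + coeff G n"
  by transfer simp

lemma coeff_cscale [simp]: "coeff (cscale c F) n = c * coeff F n"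
  by transfer simp

lemma coeff_divide_pow:
  "coeff (divide_pow F d) n = (if n > 0 \<and> d dvd n then coeff F (n div d) else 0)"
  by transfer simp

lemma coeff_sum [simp]: "coeff (\<Sum>i\<in>A. F i) n = (\<Sum>i\<in>A. coeff (F i) n)"
  by (induction A rule: infinite_finite_induct) auto

lemma dseries_eqI: "(\<And>n. n > 0 \<Longrightarrow> coeff F n = coeff G n) \<Longrightarrow> F = G"
  by transfer (metis ext gr0I)


section \<open>The space of series with periodic coefficients\<close>

definition Hsp :: "nat \<Rightarrow> dseries set" where
  "Hsp q = {F. \<forall>n\<ge>1. coeff F (n + q) = coeff F n}"

definition hprod :: "nat \<Rightarrow> dseries \<Rightarrow> dseries \<Rightarrow> complex" where
  "hprod q F G = (\<Sum>n=1..q. coeff F n * cnj (coeff G n))"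

text \<open>
  A family \<open>b\<close> indexed by \<open>I\<close> is a basis if it is injective and its range is a linearly independent
  set spanning the whole space.
\<close>

definition orthogonal_basis :: "nat \<Rightarrow> 'i set \<Rightarrow> ('i \<Rightarrow> dseries) \<Rightarrow> bool" where
  "orthogonal_basis q I b \<longleftrightarrow>
     b ` I \<subseteq> Hsp q \<and>
     inj_on b I \<and> \<not> dseries.dependent (b ` I) \<and> dseries.span (b ` I) = Hsp q \<and>
     (\<forall>i\<in>I. \<forall>j\<in>I. i \<noteq> j \<longrightarrow> hprod q (b i) (b j) = 0)"

definition orthogonal_direct_sum :: "nat \<Rightarrow> 'i set \<Rightarrow> ('i \<Rightarrow> dseries set) \<Rightarrow> bool" where
  "orthogonal_direct_sum q I E \<longleftrightarrow>
     finite I \<and>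
     (\<forall>i\<in>I. dseries.subspace (E i) \<and> E i \<subseteq> Hsp q) \<and>
     (\<forall>F\<in>Hsp q. \<exists>!v. v \<in> (\<Pi>\<^sub>E i\<in>I. E i) \<and> F = (\<Sum>i\<in>I. v i)) \<and>
     (\<forall>i\<in>I. \<forall>j\<in>I. i \<noteq> j \<longrightarrow> (\<forall>F\<in>E i. \<forall>G\<in>E j. hprod q F G = 0))"


section \<open>Dirichlet characters\<close>

definition dirichlet_char :: "nat \<Rightarrow> (nat \<Rightarrow> complex) \<Rightarrow> bool" where
  "dirichlet_char m \<chi> \<longleftrightarrow>
     m > 0 \<and> \<chi> 1 = 1 \<and> (\<forall>a b. \<chi> (a * b) = \<chi> a * \<chi> b) \<and>
     (\<forall>a. \<chi> (a + m) = \<chi> a) \<and> (\<forall>a. \<chi> a = 0 \<longleftrightarrow> \<not> coprime a m)"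

definition induces :: "nat \<Rightarrow> (nat \<Rightarrow> complex) \<Rightarrow> nat \<Rightarrow> (nat \<Rightarrow> complex) \<Rightarrow> bool" where
  "induces f \<psi> m \<chi> \<longleftrightarrow>
     f dvd m \<and> dirichlet_char f \<psi> \<and> dirichlet_char m \<chi> \<and> (\<forall>a. coprime a m \<longrightarrow> \<chi> a = \<psi> a)"

text \<open>
  The modulus is an argument because the function alone does not determine it: the indicator
  function of the odd numbers is a Dirichlet character modulo 2 and also modulo 4.
\<close>

definition conductor :: "nat \<Rightarrow> (nat \<Rightarrow> complex) \<Rightarrow> nat" where
  "conductor m \<chi> = (LEAST f. \<exists>\<psi>. induces f \<psi> m \<chi>)"

definition primitive_char :: "nat \<Rightarrow> (nat \<Rightarrow> complex) \<Rightarrow> bool" where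
  "primitive_char m \<chi> \<longleftrightarrow> dirichlet_char m \<chi> \<and> conductor m \<chi> = m"

text \<open>Primitive characters are represented as pairs of a modulus and a function.\<close>

definition Dpr :: "nat \<Rightarrow> (nat \<times> (nat \<Rightarrow> complex)) set" where
  "Dpr q = {(f, \<psi>). primitive_char f \<psi> \<and> (\<exists>\<chi>. induces f \<psi> q \<chi>)}"

definition Lser :: "(nat \<Rightarrow> complex) \<Rightarrow> dseries" where
  "Lser \<chi> = dseries_of \<chi>"

definition Esp :: "nat \<Rightarrow> nat \<times> (nat \<Rightarrow> complex) \<Rightarrow> dseries set" where
  "Esp q = (\<lambda>(f, \<psi>). dseries.span {divide_pow (Lser \<psi>) d | d. d dvd q div conductor f \<psi>})"


section \<open>Consistency of the definitions\<close>

lemma subspace_Hsp: "dseries.subspace (Hsp q)"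
  by (auto simp: dseries.subspace_def Hsp_def)

lemma coeff_mod:
  assumes "F \<in> Hsp q" "n > 0"
  shows "coeff F (n + k * q) = coeff F n"
proof (induction k)
  case (Suc k)
  have "coeff F ((n + k * q) + q) = coeff F (n + k * q)"
    using assms by (simp add: Hsp_def)
  with Suc show ?case by (simp add: algebra_simps)
qed simp

lemma Hsp_eqI:
  assumes "q > 0" "F \<in> Hsp q" "G \<in> Hsp q" "\<And>n. n \<in> {1..q} \<Longrightarrow> coeff F n = coeff G n"
  shows "F = G"
proof (rule dseries_eqI)
  fix n :: nat assume n: "n > 0"
  define r k where "r = Suc ((n - 1) mod q)" and "k = (n - 1) div q"
  have nr: "n = r + k * q" and r: "r \<in> {1..q}"
    using n \<open>q > 0\<close> by (auto simp: r_def k_def Suc_le_eq)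
  show "coeff F n = coeff G n"
    using assms(4)[OF r] coeff_mod[OF assms(2), of r k] coeff_mod[OF assms(3), of r k] r nr by auto
qed

lemma hprod_add_left: "hprod q (F + G) K = hprod q F K + hprod q G K"
  by (simp add: hprod_def algebra_simps sum.distrib)

lemma hprod_cscale_left: "hprod q (cscale c F) G = c * hprod q F G"
  by (simp add: hprod_def sum_distrib_left mult.assoc)

lemma hprod_commute: "hprod q G F = cnj (hprod q F G)"
  by (simp add: hprod_def mult.commute)

lemma hprod_self: "hprod q F F = of_real (\<Sum>n=1..q. (cmod (coeff F n))\<^sup>2)"
  by (simp add: hprod_def complex_norm_square[symmetric] del: of_real_power)

lemma hprod_self_eq_0_iff:
  assumes "q > 0" "F \<in> Hsp q"
  shows "hprod q F F = 0 \<longleftrightarrow> F = 0"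
proof
  assume "hprod q F F = 0"
  hence "(\<Sum>n=1..q. (cmod (coeff F n))\<^sup>2) = 0"
    by (simp only: hprod_self of_real_eq_0_iff)
  hence "\<forall>n\<in>{1..q}. coeff F n = 0"
    by (subst (asm) sum_nonneg_eq_0_iff) auto
  thus "F = 0"
    using assms dseries.subspace_0[OF subspace_Hsp] by (intro Hsp_eqI[of q]) auto
qed (simp add: hprod_def)

definition dser_unit :: "nat \<Rightarrow> nat \<Rightarrow> dseries" where
  "dser_unit q i = dseries_of (\<lambda>n. if n mod q = i mod q then 1 else 0)"

lemma coeff_dser_unit:
  assumes "n \<in> {1..q}" "i \<in> {1..q}"
  shows "coeff (dser_unit q i) n = (if n = i then 1 else 0)"
proof -
  have "n = i" if "n mod q = i mod q"
    using assms that by (cases "n = q"; cases "i = q") auto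
  thus ?thesis using assms by (auto simp: dser_unit_def coeff_dseries_of)
qed

lemma dim_Hsp:
  assumes "q > 0"
  shows "dseries.dim (Hsp q) = q"
proof -
  let ?B = "dser_unit q ` {1..q}"
  have inj: "inj_on (dser_unit q) {1..q}"
  proof (rule inj_onI)
    fix i j assume ij: "i \<in> {1..q}" "j \<in> {1..q}" "dser_unit q i = dser_unit q j"
    show "i = j"
      using coeff_dser_unit[OF ij(1) ij(1)] coeff_dser_unit[OF ij(1) ij(2)] ij(3)
      by (auto split: if_splits)
  qed
  have sub: "?B \<subseteq> Hsp q"
    by (auto simp: Hsp_def dser_unit_def coeff_dseries_of)
  have "Hsp q \<subseteq> dseries.span ?B"
  proof
    fix F assume F: "F \<in> Hsp q"
    let ?G = "\<Sum>i=1..q. cscale (coeff F i) (dser_unit q i)"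
    have G: "?G \<in> dseries.span ?B"
      by (intro dseries.span_sum dseries.span_scale dseries.span_base) auto
    have "F = ?G"
    proof (rule Hsp_eqI[OF assms F])
      show "?G \<in> Hsp q"
        using sub by (intro dseries.subspace_sum subspace_Hsp dseries.subspace_scale) auto
    next
      fix n assume n: "n \<in> {1..q}"
      have "coeff ?G n = (\<Sum>i=1..q. if i = n then coeff F i else 0)"
        unfolding coeff_sum using n by (intro sum.cong) (simp_all add: coeff_dser_unit)
      thus "coeff F n = coeff ?G n" using n by simp
    qed
    with G show "F \<in> dseries.span ?B" by metis
  qed
  moreover have "\<not> dseries.dependent ?B"
  proof
    assume "dseries.dependent ?B"
    then obtain u where u: "\<exists>v\<in>?B. u v \<noteq> 0" "(\<Sum>v\<in>?B. cscale (u v) v) = 0"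
      by (subst (asm) dseries.dependent_finite) auto
    from u(2) have 0: "(\<Sum>i=1..q. cscale (u (dser_unit q i)) (dser_unit q i)) = 0"
      by (simp only: sum.reindex[OF inj] o_def)
    have "u (dser_unit q n) = 0" if n: "n \<in> {1..q}" for n
    proof -
      have "0 = coeff (\<Sum>i=1..q. cscale (u (dser_unit q i)) (dser_unit q i)) n"
        by (simp only: 0 coeff_zero)
      also have "\<dots> = (\<Sum>i=1..q. if i = n then u (dser_unit q i) else 0)"
        unfolding coeff_sum using n by (intro sum.cong) (simp_all add: coeff_dser_unit)
      finally show ?thesis using n by simp
    qed
    with u(1) show False by auto
  qed
  ultimately have "dseries.dim (Hsp q) = card ?B"
    using sub by (intro dseries.dim_unique[OF sub]) auto
  thus ?thesis by (simp only: card_image[OF inj] card_atLeastAtMost diff_Suc_1)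
qed

lemma dirichlet_char_add_mult:
  assumes "dirichlet_char m \<chi>"
  shows "\<chi> (a + k * m) = \<chi> a"
proof (induction k)
  case (Suc k)
  have "\<chi> ((a + k * m) + m) = \<chi> (a + k * m)"
    using assms by (simp add: dirichlet_char_def)
  with Suc show ?case by (simp add: algebra_simps)
qed simp

lemma divide_pow_Lser_in_Hsp:
  assumes "dirichlet_char m \<chi>" "d * m dvd q" "q > 0"
  shows "divide_pow (Lser \<chi>) d \<in> Hsp q"
proof -
  from assms(2) obtain k where "q = d * m * k" ..
  hence q: "q = d * (k * m)" by (simp add: mult_ac)
  have "d > 0" using q assms(3) by auto
  show ?thesis unfolding Hsp_def
  proof safe
    fix n :: nat assume n: "1 \<le> n"
    show "coeff (divide_pow (Lser \<chi>) d) (n + q) = coeff (divide_pow (Lser \<chi>) d) n"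
    proof (cases "d dvd n")
      case True
      then obtain j where j: "n = d * j" by auto
      have "n + q = d * (j + k * m)" by (simp add: j q algebra_simps)
      thus ?thesis
        using n j \<open>d > 0\<close> dirichlet_char_add_mult[OF assms(1), of j k]
        by (simp add: coeff_divide_pow Lser_def coeff_dseries_of)
    next
      case False
      hence "\<not> d dvd n + q" by (simp add: q dvd_add_left_iff)
      with False show ?thesis by (simp add: coeff_divide_pow)
    qed
  qed
qed

lemma Dpr_iff:
  assumes "q > 0"
  shows "(f, \<psi>) \<in> Dpr q \<longleftrightarrow> primitive_char f \<psi> \<and> conductor f \<psi> dvd q"
proof
  assume "primitive_char f \<psi> \<and> conductor f \<psi> dvd q"
  hence p: "primitive_char f \<psi>" "dirichlet_char f \<psi>" "f dvd q"
    by (auto simp: primitive_char_def)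
  from p(3) obtain k where "q = f * k" ..
  hence q: "q = k * f" by (simp add: mult.commute)
  define \<chi> where "\<chi> = (\<lambda>a. if coprime a q then \<psi> a else 0)"
  have cop: "coprime a f" if "coprime a q" for a
    using that p(3) by (rule coprime_divisors[OF dvd_refl, rotated])
  have per: "\<psi> (a + q) = \<psi> a" for a
    using dirichlet_char_add_mult[OF p(2)] by (simp add: q)
  have cpq: "coprime (a + q) q \<longleftrightarrow> coprime a q" for a
    by (simp add: coprime_iff_gcd_eq_1)
  have "dirichlet_char q \<chi>"
    using p(2) assms cop per cpq
    by (auto simp: dirichlet_char_def \<chi>_def)
  hence "induces f \<psi> q \<chi>"
    using p by (auto simp: induces_def \<chi>_def)
  thus "(f, \<psi>) \<in> Dpr q" using p by (auto simp: Dpr_def)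
qed (auto simp: Dpr_def primitive_char_def induces_def)

end

theory Submission
  imports "HOL-Number_Theory.Residues" Defs
begin

text \<open>
  For \<open>a\<close> coprime to \<open>q\<close>, the dilation \<open>F(n) \<mapsto> F(an)\<close> of coefficients is a unitary operator \<open>T\<^sub>a\<close> on \<open>H\<^sub>q\<close>, and \<open>L\<^sub>\<chi>/d\<^sup>s\<close> is an
  eigenvector with eigenvalue \<open>\<chi>(a)\<close>. Series belonging to characters that differ somewhere on the
  integers coprime to \<open>q\<close> are therefore orthogonal; for different \<open>d\<close> the series in (i) have disjoint
  supports \<open>gcd(n, q) = d\<close>. They span: a series supported on \<open>gcd(n, q) = d\<close> comes from one modulo
  \<open>m = q/d\<close> supported on the integers coprime to \<open>m\<close>, on which the commuting operators \<open>T\<^sub>a\<close> of finite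
  order are simultaneously diagonalizable, and a joint eigenvector is a multiple of a character.
  For (ii), distinct primitive characters differ on the integers coprime to \<open>q\<close>, and each
  \<open>L\<^sub>\<chi>/d\<^sup>s\<close> lies in the space of the primitive character inducing \<open>\<chi>\<close>.
\<close>

section \<open>Congruences and characters\<close>

text \<open>Let \<open>t\<close> be the product of the primes that divide \<open>m\<close> but not
  \<open>a\<close>. Each prime divisor of \<open>m\<close> then divides exactly one of
  \<open>a\<close> and \<open>f * t\<close>, so \<open>a + f * t\<close> is prime to
  \<open>m\<close>.\<close>

lemma coprime_lift:
  fixes a f m :: nat
  assumes "coprime a f" "m > 0"
  obtains b where "[b = a] (mod f)" "coprime b m"
proof -
  define t where "t = \<Prod>{p. prime p \<and> p dvd m \<and> \<not> p dvd a}"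
  have fin: "finite {p. prime p \<and> p dvd m \<and> \<not> p dvd a}"
    using assms(2) by (intro finite_subset[OF _ finite_divisors_nat[OF assms(2)]]) auto
  have pt: "p dvd t \<longleftrightarrow> \<not> p dvd a" if "prime p" "p dvd m" for p
  proof
    assume "p dvd t"
    with fin that(1) obtain r where "prime r" "\<not> r dvd a" "p dvd r"
      by (auto simp: t_def prime_dvd_prod_iff)
    with that(1) show "\<not> p dvd a" using primes_dvd_imp_eq by blast
  next
    assume "\<not> p dvd a"
    thus "p dvd t" using that fin by (auto simp: t_def intro!: dvd_prodI[of _ _ "\<lambda>x. x", simplified])
  qed
  have "coprime (a + f * t) m"
  proof (rule ccontr)
    assume "\<not> coprime (a + f * t) m"
    then obtain p where p: "prime p" "p dvd a + f * t" "p dvd m"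
      by (metis coprime_iff_gcd_eq_1 gcd_nat.bounded_iff prime_factor_nat)
    show False
    proof (cases "p dvd a")
      case True
      hence "p dvd f * t" using p(2) by (simp add: dvd_add_right_iff)
      hence "p dvd f" using pt[OF p(1,3)] True prime_dvd_multD[OF p(1)] by blast
      with True assms(1) p(1) show False
        using coprime_common_divisor_nat not_prime_1 by metis
    next
      case False
      hence "p dvd f * t" using pt[OF p(1,3)] by simp
      hence "p dvd a" using p(2) by (simp add: dvd_add_left_iff)
      with False show False by simp
    qed
  qed
  moreover have "[a + f * t = a] (mod f)" by (simp add: cong_def)
  ultimately show ?thesis using that by blast
qed

lemma dirichlet_char_cong:
  assumes "dirichlet_char m \<chi>" "[a = b] (mod m)"
  shows "\<chi> a = \<chi> b"
proof -
  have "\<chi> n = \<chi> (n mod m)" for n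
    using dirichlet_char_add_mult[OF assms(1), of "n mod m" "n div m"] by simp
  thus ?thesis using assms(2) by (metis cong_def)
qed

lemma dirichlet_char_mult: "dirichlet_char m \<chi> \<Longrightarrow> \<chi> (a * b) = \<chi> a * \<chi> b"
  by (simp add: dirichlet_char_def)

lemma dirichlet_char_1: "dirichlet_char m \<chi> \<Longrightarrow> \<chi> (Suc 0) = 1"
  by (simp add: dirichlet_char_def)

lemma dirichlet_char_eq_0_iff: "dirichlet_char m \<chi> \<Longrightarrow> \<chi> a = 0 \<longleftrightarrow> \<not> coprime a m"
  by (simp add: dirichlet_char_def)

lemma dirichlet_char_power: "dirichlet_char m \<chi> \<Longrightarrow> \<chi> (a ^ k) = \<chi> a ^ k"
  by (induction k) (simp_all add: dirichlet_char_mult dirichlet_char_1)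

text \<open>Euler's theorem makes \<open>\<chi> a\<close> a root of unity.\<close>

lemma norm_dirichlet_char:
  assumes "dirichlet_char m \<chi>" "coprime a m"
  shows "cmod (\<chi> a) = 1"
proof -
  have "m > 0" using assms(1) by (simp add: dirichlet_char_def)
  have "\<chi> a ^ totient m = 1"
    using dirichlet_char_cong[OF assms(1) euler_theorem[OF assms(2)]]
    by (simp add: dirichlet_char_power[OF assms(1)] dirichlet_char_1[OF assms(1)])
  hence "cmod (\<chi> a) ^ totient m = 1" by (metis norm_one norm_power)
  thus ?thesis using \<open>m > 0\<close>
    by (metis norm_ge_zero power_eq_1_iff totient_gt_0_iff gr_implies_not0 abs_of_nonneg real_norm_def)
qed

text \<open>Every residue class of units modulo \<open>m\<close> contains an integer prime to
  \<open>q\<close>, so the values at such integers determine the character.\<close>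

lemma dirichlet_char_eqI:
  assumes "dirichlet_char m \<chi>" "dirichlet_char m \<chi>'" "q > 0"
    "\<And>a. coprime a q \<Longrightarrow> \<chi> a = \<chi>' a"
  shows "\<chi> = \<chi>'"
proof
  fix a
  show "\<chi> a = \<chi>' a"
  proof (cases "coprime a m")
    case True
    then obtain b where "[b = a] (mod m)" "coprime b q" using coprime_lift assms(3) by blast
    thus ?thesis using assms dirichlet_char_cong by metis
  qed (use assms(1,2) dirichlet_char_eq_0_iff in metis)
qed

section \<open>Primitive characters\<close>

text \<open>If the modulus of \<open>\<psi>\<close> divides \<open>m > 0\<close>, this is the
  character modulo \<open>m\<close> induced by \<open>\<psi>\<close>. The formula is kept for all
  \<open>m\<close>, since the expansion of \<open>Lser \<psi>\<close> over divisors below also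
  produces other values of \<open>m\<close>.\<close>

definition extend_char :: "(nat \<Rightarrow> complex) \<Rightarrow> nat \<Rightarrow> nat \<Rightarrow> complex" where
  "extend_char \<psi> m a = (if coprime a m then \<psi> a else 0)"

lemma induces_eq_extend_char: "induces f \<psi> m \<chi> \<Longrightarrow> \<chi> = extend_char \<psi> m"
  by (auto simp: fun_eq_iff induces_def extend_char_def dirichlet_char_def)

lemma induces_trans:
  assumes "induces f \<psi> g \<phi>" "induces g \<phi> m \<chi>"
  shows "induces f \<psi> m \<chi>"
proof -
  have "coprime a g" if "coprime a m" for a
    using assms(2) that by (auto simp: induces_def intro: coprime_divisors[OF dvd_refl])
  thus ?thesis using assms by (auto simp: induces_def)
qed

lemma induces_refl: "dirichlet_char m \<chi> \<Longrightarrow> induces m \<chi> m \<chi>"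
  by (simp add: induces_def)

text \<open>The least inducing modulus works: whatever induces \<open>\<psi>\<close> also induces
  \<open>\<chi>\<close> by transitivity, so minimality makes \<open>f\<close> the conductor of
  \<open>\<psi>\<close>.\<close>

lemma ex_primitive_inducing:
  assumes "dirichlet_char m \<chi>"
  obtains f \<psi> where "primitive_char f \<psi>" "induces f \<psi> m \<chi>"
proof -
  let ?P = "\<lambda>f. \<exists>\<psi>. induces f \<psi> m \<chi>"
  define f where "f = (LEAST f. ?P f)"
  have "?P f" unfolding f_def by (rule LeastI[of ?P m]) (use assms induces_refl in blast)
  then obtain \<psi> where \<psi>: "induces f \<psi> m \<chi>" by blast
  have "conductor f \<psi> = f"
    unfolding conductor_def
  proof (rule Least_equality)
    show "\<exists>\<phi>. induces f \<phi> f \<psi>" using \<psi> induces_refl by (auto simp: induces_def)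
  next
    fix g assume "\<exists>\<phi>. induces g \<phi> f \<psi>"
    then have "?P g" using \<psi> induces_trans by blast
    thus "f \<le> g" unfolding f_def by (rule Least_le)
  qed
  with \<psi> that show ?thesis by (auto simp: primitive_char_def induces_def)
qed

section \<open>Descent of two characters to the gcd of their moduli\<close>

lemma chinese_remainder_gcd:
  fixes a b f g :: nat
  assumes "[a = b] (mod gcd f g)" "f > 0"
  obtains c where "[c = a] (mod f)" "[c = b] (mod g)"
proof -
  have "[int a = int b] (mod int (gcd f g))"
    using assms(1) by (simp add: cong_int_iff)
  hence "gcd (int f) (int g) dvd int b - int a"
    by (simp add: cong_iff_dvd_diff dvd_diff_commute)
  then obtain k where k: "int b - int a = gcd (int f) (int g) * k" ..
  obtain u v where uv: "u * int f + v * int g = gcd (int f) (int g)"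
    using bezout_int by blast
  \<comment> \<open>Substituting the Bezout identity into \<open>b - a = gcd f g * k\<close> gives
    \<open>z - b = - v * k * g\<close>, so \<open>z\<close> has the required residues for both
    moduli.\<close>
  define z where "z = int a + u * k * int f"
  have za: "[z = int a] (mod int f)" by (simp add: z_def cong_iff_dvd_diff)
  have "int b = int a + (u * int f + v * int g) * k" using k uv by simp
  hence "z - int b = int g * (- v * k)" by (simp add: z_def algebra_simps)
  hence zb: "[z = int b] (mod int g)" by (metis cong_iff_dvd_diff dvd_triv_left)
  show ?thesis
  proof (cases "g = 0")
    case True
    hence "z = int b" using zb by (simp add: cong_def)
    hence "[b = a] (mod f)" using za by (simp add: cong_int_iff)
    thus ?thesis using that by auto
  next
    case False
    define c where "c = nat (z mod int (f * g))"
    have c: "int c = z mod int (f * g)" using False assms(2) by (simp add: c_def)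
    have "[int c = z] (mod int f)" "[int c = z] (mod int g)"
      unfolding c by (auto simp: cong_def mod_mod_cancel)
    hence "[int c = int a] (mod int f)" "[int c = int b] (mod int g)"
      using za zb cong_trans by blast+
    thus ?thesis using that by (auto simp: cong_int_iff)
  qed
qed

text \<open>On integers prime to \<open>m\<close> the common value of the two characters is
  determined modulo \<open>f\<close> as well as modulo \<open>f'\<close>. By the Chinese remainder
  theorem it is then determined modulo the gcd, which yields the character
  \<open>\<phi>\<close>.\<close>

lemma induces_gcd_modulus:
  assumes "dirichlet_char f \<psi>" "dirichlet_char f' \<psi>'" "f dvd m" "f' dvd m" "m > 0"
    and agree: "\<And>a. coprime a m \<Longrightarrow> \<psi> a = \<psi>' a"
  obtains \<phi> where "induces (gcd f f') \<phi> f \<psi>" "induces (gcd f f') \<phi> f' \<psi>'"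
proof -
  define g where "g = gcd f f'"
  have pos: "f > 0" "f' > 0" "g > 0"
    using assms(1,2) by (auto simp: dirichlet_char_def g_def)
  have cop: "coprime a f \<and> coprime a f'" if "coprime a m" for a
    using that assms(3,4) by (auto intro: coprime_divisors[OF dvd_refl])
  have copg: "coprime a g" if "coprime a f" for a
    using that by (auto simp: g_def intro: coprime_divisors[OF dvd_refl])
  \<comment> \<open>With \<open>y\<close> congruent to \<open>b\<close> modulo \<open>f\<close>,
    congruent to \<open>c\<close> modulo \<open>f'\<close> and prime to \<open>m\<close>, the chain
    is \<open>\<psi> b = \<psi> y = \<psi>' y = \<psi>' c = \<psi> c\<close>.\<close>
  have wd: "\<psi> b = \<psi> c" if bc: "[b = c] (mod g)" "coprime b m" "coprime c m" for b c
  proof -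
    obtain x where x: "[x = b] (mod f)" "[x = c] (mod f')"
      using chinese_remainder_gcd bc(1) pos(1) unfolding g_def by blast
    have "coprime x f" "coprime x f'"
      using x cop bc by (metis cong_imp_coprime cong_sym)+
    hence "coprime x (f * f')" by simp
    then obtain y where y: "[y = x] (mod (f * f'))" "coprime y m"
      using coprime_lift assms(5) by blast
    have "[y = b] (mod f)" "[y = c] (mod f')"
      using y(1) x by (meson cong_modulus_mult_nat cong_trans,
          metis cong_modulus_mult_nat cong_trans mult.commute)
    hence "\<psi> b = \<psi> y" "\<psi>' c = \<psi>' y"
      using assms(1,2) dirichlet_char_cong by (metis, metis)
    thus ?thesis using agree y(2) bc(3) by simp
  qed
  \<comment> \<open>A class of units modulo \<open>g\<close> is evaluated at a representative prime
    to \<open>m\<close>; by \<open>wd\<close> its choice does not matter.\<close>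
  define r where "r a = (SOME b. [b = a] (mod g) \<and> coprime b m)" for a
  have r: "[r a = a] (mod g) \<and> coprime (r a) m" if "coprime a g" for a
    unfolding r_def by (rule someI_ex) (use coprime_lift[OF that assms(5)] in blast)
  define \<phi> where "\<phi> a = (if coprime a g then \<psi> (r a) else 0)" for a
  have \<phi>I: "\<phi> a = \<psi> b" if "[b = a] (mod g)" "coprime b m" for a b
  proof -
    have "coprime a g" using that cop copg cong_imp_coprime by blast
    moreover have "[r a = b] (mod g)"
      using r[OF calculation] that(1) by (meson cong_sym cong_trans)
    ultimately show ?thesis using r wd that by (simp add: \<phi>_def)
  qed
  have \<phi>1: "\<phi> 1 = 1"
    using \<phi>I[of 1 1] dirichlet_char_1[OF assms(1)] by simp
  have \<phi>m: "\<phi> (a * b) = \<phi> a * \<phi> b" for a b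
  proof (cases "coprime a g \<and> coprime b g")
    case True
    hence "\<phi> (a * b) = \<psi> (r a * r b)" using r by (intro \<phi>I cong_mult) auto
    thus ?thesis using True assms(1) by (simp add: \<phi>_def dirichlet_char_mult)
  qed (auto simp: \<phi>_def)
  have \<phi>p: "\<phi> (a + g) = \<phi> a" for a
  proof (cases "coprime a g")
    case True
    have "[r a = a + g] (mod g)" using r[OF True] by (simp add: cong_def)
    thus ?thesis using r[OF True] True \<phi>I[of "r a" "a + g"] by (simp add: \<phi>_def)
  next
    case False
    hence "\<not> coprime (a + g) g" by (simp add: coprime_iff_gcd_eq_1)
    with False show ?thesis by (simp add: \<phi>_def)
  qed
  have \<phi>0: "\<phi> a = 0 \<longleftrightarrow> \<not> coprime a g" for a
    using r[of a] cop dirichlet_char_eq_0_iff[OF assms(1)] by (auto simp: \<phi>_def)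
  have d: "dirichlet_char g \<phi>"
    using \<phi>1 \<phi>m \<phi>p \<phi>0 pos by (simp add: dirichlet_char_def)
  have "\<psi> a = \<phi> a" if a: "coprime a f" for a
  proof -
    obtain b where b: "[b = a] (mod f)" "coprime b m" using coprime_lift[OF a assms(5)] .
    hence "[b = a] (mod g)" unfolding g_def using cong_dvd_modulus_nat gcd_dvd1 by blast
    thus ?thesis using \<phi>I b dirichlet_char_cong[OF assms(1)] by metis
  qed
  moreover have "\<psi>' a = \<phi> a" if a: "coprime a f'" for a
  proof -
    obtain b where b: "[b = a] (mod f')" "coprime b m" using coprime_lift[OF a assms(5)] .
    hence "[b = a] (mod g)" unfolding g_def using cong_dvd_modulus_nat gcd_dvd2 by blast
    thus ?thesis using \<phi>I b agree dirichlet_char_cong[OF assms(2)] by metis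
  qed
  ultimately show ?thesis
    using that[of \<phi>] d assms(1,2) by (simp add: induces_def g_def)
qed

text \<open>Both characters are induced from the modulus \<open>gcd f f'\<close>, so primitivity
  forces \<open>f\<close> and \<open>f'\<close> to equal it.\<close>

lemma primitive_char_unique:
  assumes "primitive_char f \<psi>" "primitive_char f' \<psi>'" "f dvd m" "f' dvd m" "m > 0"
    and "\<And>a. coprime a m \<Longrightarrow> \<psi> a = \<psi>' a"
  shows "f = f' \<and> \<psi> = \<psi>'"
proof -
  have ch: "dirichlet_char f \<psi>" "dirichlet_char f' \<psi>'"
    using assms by (auto simp: primitive_char_def)
  hence pos: "f > 0" "f' > 0" by (auto simp: dirichlet_char_def)
  obtain \<phi> where \<phi>: "induces (gcd f f') \<phi> f \<psi>" "induces (gcd f f') \<phi> f' \<psi>'"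
    using induces_gcd_modulus[OF ch assms(3-6)] by blast
  have "conductor f \<psi> \<le> gcd f f'" "conductor f' \<psi>' \<le> gcd f f'"
    unfolding conductor_def using \<phi> by (blast intro: Least_le)+
  hence "f \<le> gcd f f'" "f' \<le> gcd f f'"
    using assms by (auto simp: primitive_char_def)
  hence "f = f'" using pos by (metis gcd_le1_nat gcd_le2_nat le_antisym less_numeral_extra(3))
  thus ?thesis using dirichlet_char_eqI[OF ch(1)] ch(2) assms(5,6) by blast
qed

section \<open>Translations by units\<close>

definition translate :: "nat \<Rightarrow> dseries \<Rightarrow> dseries" where
  "translate a F = dseries_of (\<lambda>n. coeff F (a * n))"

lemma coeff_translate [simp]: "coeff (translate a F) n = coeff F (a * n)"
  by (simp add: translate_def coeff_dseries_of)

lemma coeff_cong: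
  assumes "F \<in> Hsp m" "[x = y] (mod m)" "x > 0" "y > 0"
  shows "coeff F x = coeff F y"
  using assms(2-4)
proof (induction x y rule: linorder_wlog)
  case (le a b)
  then obtain k where "b = k * m + a" by (metis cong_le_nat cong_sym)
  thus ?case using coeff_mod[OF assms(1), of a k] le by (simp add: add.commute)
qed (metis cong_sym)

text \<open>Multiplication by \<open>a\<close> permutes the residue classes modulo
  \<open>q\<close>.\<close>

lemma sum_coprime_dilation:
  fixes h :: "nat \<Rightarrow> complex"
  assumes "coprime a q" "a > 0" "q > 0" and per: "\<And>n. n > 0 \<Longrightarrow> h (n + q) = h n"
  shows "(\<Sum>n=1..q. h (a * n)) = (\<Sum>n=1..q. h n)"
proof -
  \<comment> \<open>\<open>H\<close> is the periodic continuation of \<open>h\<close> to index 0: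
    adding \<open>q\<close> keeps the argument positive, where periodicity of \<open>h\<close> is
    assumed. This allows the sum over \<open>1..q\<close> to be moved to the residues
    \<open>0..<q\<close>.\<close>
  define H where "H n = h (n mod q + q)" for n
  have hk: "h (n + k * q) = h n" if "n > 0" for n k
    using that
  proof (induction k)
    case (Suc k)
    thus ?case using per[of "n + k * q"] by (simp add: algebra_simps)
  qed simp
  have hH: "h n = H n" if "n > 0" for n
  proof -
    have "h (n + q) = h ((n mod q + q) + (n div q) * q)" by (simp add: algebra_simps)
    also have "\<dots> = H n" unfolding H_def using assms(3) by (intro hk) simp
    finally show ?thesis using per that by simp
  qed
  have shift: "(\<Sum>n=1..q. K n) = (\<Sum>n<q. K n)" if "K q = K 0" for K :: "nat \<Rightarrow> complex"
  proof -
    have "(\<Sum>n=1..q. K n) = (\<Sum>n<q. K (Suc n))"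
      by (rule sum.reindex_bij_witness[of _ Suc "\<lambda>n. n - 1"]) auto
    thus ?thesis using sum.lessThan_Suc_shift[of K q] that by (simp add: add.commute)
  qed
  have inj: "inj_on (\<lambda>n. a * n mod q) {..<q}"
  proof (rule inj_onI)
    fix x y assume xy: "x \<in> {..<q}" "y \<in> {..<q}" "a * x mod q = a * y mod q"
    hence "[x = y] (mod q)" using assms(1) by (metis cong_def cong_mult_lcancel_nat)
    thus "x = y" using xy by (simp add: cong_def)
  qed
  have im: "(\<lambda>n. a * n mod q) ` {..<q} = {..<q}"
    using inj assms(3) by (intro endo_inj_surj) auto
  have "(\<Sum>n=1..q. h (a * n)) = (\<Sum>n=1..q. H (a * n))"
    using assms(2) by (intro sum.cong refl hH) auto
  also have "\<dots> = (\<Sum>n<q. H (a * n))" by (rule shift) (simp add: H_def)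
  also have "\<dots> = (\<Sum>n<q. H (a * n mod q))" by (simp add: H_def)
  also have "\<dots> = sum H ((\<lambda>n. a * n mod q) ` {..<q})" using sum.reindex[OF inj, of H] by simp
  also have "\<dots> = (\<Sum>n<q. H n)" by (simp only: im)
  also have "\<dots> = (\<Sum>n=1..q. H n)" by (rule shift[symmetric]) (simp add: H_def)
  also have "\<dots> = (\<Sum>n=1..q. h n)" by (intro sum.cong refl hH[symmetric]) auto
  finally show ?thesis .
qed

lemma translate_cscale: "translate a (cscale c F) = cscale c (translate a F)"
  by (rule dseries_eqI) simp

lemma translate_sum: "translate a (\<Sum>i\<in>A. F i) = (\<Sum>i\<in>A. translate a (F i))"
  by (rule dseries_eqI) simp

lemma translate_commute: "translate a (translate b F) = translate b (translate a F)"
  by (rule dseries_eqI) (simp add: mult.left_commute)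

lemma hprod_translate:
  assumes "coprime a q" "a > 0" "q > 0" "F \<in> Hsp q" "G \<in> Hsp q"
  shows "hprod q (translate a F) (translate a G) = hprod q F G"
  unfolding hprod_def coeff_translate using assms
  by (intro sum_coprime_dilation) (auto simp: Hsp_def)

lemma hprod_cscale_right: "hprod q F (cscale c G) = cnj c * hprod q F G"
  by (simp add: hprod_def sum_distrib_left mult_ac)

text \<open>Unitarity gives \<open>hprod q F G = x * cnj y * hprod q F G\<close>, and
  \<open>cnj y\<close> is the inverse of \<open>y\<close>, so the factor is not 1.\<close>

lemma hprod_eq_0_if_eigen:
  assumes "coprime a q" "a > 0" "q > 0" "F \<in> Hsp q" "G \<in> Hsp q"
    and F: "translate a F = cscale x F" and G: "translate a G = cscale y G"
    and "cmod y = 1" "x \<noteq> y"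
  shows "hprod q F G = 0"
proof -
  have "hprod q F G = x * cnj y * hprod q F G"
    using hprod_translate[OF assms(1-5)]
    by (simp add: F G hprod_cscale_left hprod_cscale_right mult_ac)
  moreover have "x * cnj y \<noteq> 1"
  proof
    assume "x * cnj y = 1"
    moreover have "y * cnj y = 1" using assms(8) by (simp add: complex_norm_square[symmetric])
    ultimately have "x * cnj y = y * cnj y" "cnj y \<noteq> 0" by auto
    thus False using assms(9) by simp
  qed
  ultimately show ?thesis by auto
qed

lemma translate_divide_pow_Lser:
  assumes "dirichlet_char m \<chi>" "coprime a d" "a > 0"
  shows "translate a (divide_pow (Lser \<chi>) d) = cscale (\<chi> a) (divide_pow (Lser \<chi>) d)"
proof (rule dseries_eqI)
  fix n :: nat assume "n > 0"
  have "d dvd a * n \<longleftrightarrow> d dvd n"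
    using assms(2) by (simp add: coprime_commute coprime_dvd_mult_right_iff)
  moreover have "a * n div d = a * (n div d)" if "d dvd n"
    using that by (simp add: div_mult_swap)
  ultimately show "coeff (translate a (divide_pow (Lser \<chi>) d)) n =
      coeff (cscale (\<chi> a) (divide_pow (Lser \<chi>) d)) n"
    using \<open>n > 0\<close> assms(3) dirichlet_char_mult[OF assms(1)]
    by (auto simp: coeff_divide_pow Lser_def coeff_dseries_of)
qed

section \<open>Simultaneous diagonalization of the translations\<close>

definition coprime_supported :: "nat \<Rightarrow> dseries set" where
  "coprime_supported m = {F \<in> Hsp m. \<forall>n. \<not> coprime n m \<longrightarrow> coeff F n = 0}"

lemma subspace_coprime_supported: "dseries.subspace (coprime_supported m)"
  using subspace_Hsp[of m] by (auto simp: coprime_supported_def dseries.subspace_def)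

lemma translate_coprime_supported:
  assumes "coprime a m" "F \<in> coprime_supported m" "a > 0"
  shows "translate a F \<in> coprime_supported m"
proof -
  have "coeff F (a * (n + m)) = coeff F (a * n)" if "n \<ge> 1" for n
    using assms that
    by (intro coeff_cong[of _ m]) (auto simp: coprime_supported_def cong_def distrib_left)
  thus ?thesis using assms by (auto simp: coprime_supported_def Hsp_def)
qed

text \<open>
  \<open>translate a\<close> has finite order \<open>N = totient m\<close>, so \<open>\<Sum>\<^sub>k \<omega>\<^sup>j\<^sup>k translate (a\<^sup>k) F\<close> with
  \<open>\<omega> = exp (2\<pi>i/N)\<close> is, up to the factor \<open>N\<close>, the projection of \<open>F\<close> to the eigenspace of \<open>\<omega>\<^sup>-\<^sup>j\<close>.
\<close>

lemma eigenvector_decomposition: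
  assumes "m > 0" "coprime a m" "a > 0" "F \<in> coprime_supported m"
  obtains N :: nat and P :: "nat \<Rightarrow> dseries" where
    "F = (\<Sum>j<N. P j)"
    "\<And>j. P j \<in> coprime_supported m"
    "\<And>j. \<exists>c. translate a (P j) = cscale c (P j)"
    "\<And>b c j. translate b F = cscale c F \<Longrightarrow> translate b (P j) = cscale c (P j)"
proof -
  define N where "N = totient m"
  define w where "w = cis (2 * pi / N)"
  define P where "P j = (\<Sum>k<N. cscale (w ^ (j * k) / N) (translate (a ^ k) F))" for j
  have N: "N > 0" using assms(1) by (simp add: N_def)
  have wN: "w ^ N = 1" using N by (simp add: w_def DeMoivre)
  \<comment> \<open>\<open>w\<close> is a primitive \<open>N\<close>-th root of unity, which makes
    the geometric sums below vanish for \<open>0 < k < N\<close>.\<close>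
  have wk: "w ^ k \<noteq> 1" if "0 < k" "k < N" for k
  proof
    assume "w ^ k = 1"
    hence "cis (2 * pi * k / N) = 1" by (simp add: w_def DeMoivre mult_ac)
    hence "cos (2 * pi * k / N) = 1" by (simp add: complex_eq_iff)
    then obtain x :: int where "2 * pi * k / N = of_int x * 2 * pi"
      using cos_one_2pi_int by auto
    hence "real k = of_int x * real N" using N by (simp add: field_simps)
    hence "int k = x * int N" by (metis of_int_eq_iff of_int_mult of_int_of_nat_eq)
    hence "int N dvd int k" by simp
    hence "N dvd k" by simp
    thus False using that by (auto dest: dvd_imp_le)
  qed
  have aN: "translate (a ^ N) F = F"
  proof (rule dseries_eqI)
    fix n :: nat assume "n > 0"
    have "[a ^ N * n = 1 * n] (mod m)"
      unfolding N_def by (intro cong_mult euler_theorem assms cong_refl)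
    thus "coeff (translate (a ^ N) F) n = coeff F n"
      using assms \<open>n > 0\<close> coeff_cong[of F m "a ^ N * n" n]
      by (simp add: coprime_supported_def)
  qed
  have "(\<Sum>j<N. P j) = F"
  proof (rule dseries_eqI)
    fix n :: nat assume "n > 0"
    have "coeff (\<Sum>j<N. P j) n = (\<Sum>j<N. \<Sum>k<N. w ^ (j * k) / N * coeff F (a ^ k * n))"
      by (simp add: P_def)
    \<comment> \<open>After the sums are swapped, the inner sum over \<open>j\<close> equals
      \<open>N\<close> for \<open>k = 0\<close> and vanishes otherwise, so only the undilated
      \<open>F\<close> survives.\<close>
    also have "\<dots> = (\<Sum>k<N. (\<Sum>j<N. (w ^ k) ^ j) / N * coeff F (a ^ k * n))"
      by (subst sum.swap)
        (simp add: sum_distrib_left sum_divide_distrib power_mult[symmetric] mult_ac)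
    also have "\<dots> = (\<Sum>k<N. if k = 0 then coeff F n else 0)"
    proof (intro sum.cong refl)
      fix k assume "k \<in> {..<N}"
      moreover have "(\<Sum>j<N. (w ^ k) ^ j) = 0" if "k > 0" "k < N"
      proof -
        have "(w ^ k) ^ N = 1" using wN by (metis power_mult power_one mult.commute)
        thus ?thesis using wk[OF that] by (simp add: geometric_sum)
      qed
      ultimately show "(\<Sum>j<N. (w ^ k) ^ j) / N * coeff F (a ^ k * n) =
          (if k = 0 then coeff F n else 0)"
        using N by auto
    qed
    also have "\<dots> = coeff F n" using N by simp
    finally show "coeff (\<Sum>j<N. P j) n = coeff F n" .
  qed
  moreover have "P j \<in> coprime_supported m" for j
    unfolding P_def using assms
    by (intro dseries.subspace_sum subspace_coprime_supported dseries.subspace_scale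
        translate_coprime_supported) auto
  moreover have "\<exists>c. translate a (P j) = cscale c (P j)" for j
  proof -
    have w0: "w \<noteq> 0" by (simp add: w_def)
    let ?t = "\<lambda>k n. w ^ (j * k) * coeff F (a ^ k * n)"
    have "translate a (P j) = cscale (1 / w ^ j) (P j)"
    proof (rule dseries_eqI)
      fix n :: nat assume "n > 0"
      \<comment> \<open>Dilation by \<open>a\<close> shifts the summation index by one; the sum
        closes up cyclically because the terms for \<open>N\<close> and 0 agree.\<close>
      have "?t N n = ?t 0 n"
        using arg_cong[OF aN, of "\<lambda>G. coeff G n"] wN
        by (simp add: mult.commute[of j] power_mult)
      hence "(\<Sum>k<N. ?t (Suc k) n) = (\<Sum>k<N. ?t k n)"
        using sum.lessThan_Suc_shift[of "\<lambda>k. ?t k n" N]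
          sum.lessThan_Suc[of "\<lambda>k. ?t k n" N] by (simp only: add.commute add_left_cancel)
      moreover have "w ^ j * coeff (translate a (P j)) n = (\<Sum>k<N. ?t (Suc k) n) / N"
        by (simp add: P_def sum_distrib_left sum_divide_distrib power_add mult_ac)
      moreover have "coeff (P j) n = (\<Sum>k<N. ?t k n) / N"
        by (simp add: P_def sum_divide_distrib)
      ultimately have "w ^ j * coeff (translate a (P j)) n = coeff (P j) n"
        by simp
      thus "coeff (translate a (P j)) n = coeff (cscale (1 / w ^ j) (P j)) n"
        using w0 by (simp add: field_simps)
    qed
    thus ?thesis ..
  qed
  moreover have "translate b (P j) = cscale c (P j)" if "translate b F = cscale c F" for b c j
  proof -
    have "translate b (P j) = (\<Sum>k<N. cscale (w ^ (j * k) / N) (translate (a ^ k) (translate b F)))"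
      by (simp add: P_def translate_sum translate_cscale translate_commute[of b])
    also have "\<dots> = cscale c (P j)"
      unfolding that by (rule dseries_eqI) (simp add: P_def sum_distrib_left mult_ac)
    finally show ?thesis .
  qed
  ultimately show ?thesis using that[of P N] by metis
qed

text \<open>Induction on \<open>A\<close>: splitting a series into eigenvectors of the new
  translation keeps it an eigenvector of the earlier ones, since translations commute.\<close>

lemma coprime_supported_span_eigen:
  assumes "finite A" "m > 0" "\<And>a. a \<in> A \<Longrightarrow> coprime a m \<and> a > 0"
  shows "coprime_supported m \<subseteq>
    dseries.span {F \<in> coprime_supported m. \<forall>a\<in>A. \<exists>c. translate a F = cscale c F}"
  using assms(1,3)
proof (induction A)
  case empty
  show ?case by (auto intro: dseries.span_base)
next
  case (insert a A)
  let ?S = "\<lambda>A. {F \<in> coprime_supported m. \<forall>a\<in>A. \<exists>c. translate a F = cscale c F}"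
  have "?S A \<subseteq> dseries.span (?S (insert a A))"
  proof
    fix F assume F: "F \<in> ?S A"
    have a: "coprime a m" "a > 0" and F': "F \<in> coprime_supported m"
      using insert.prems[of a] F by auto
    obtain N and P :: "nat \<Rightarrow> dseries" where P: "F = (\<Sum>j<N. P j)"
      "\<And>j. P j \<in> coprime_supported m"
      "\<And>j. \<exists>c. translate a (P j) = cscale c (P j)"
      "\<And>b c j. translate b F = cscale c F \<Longrightarrow> translate b (P j) = cscale c (P j)"
      by (rule eigenvector_decomposition[OF assms(2) a F'], rule that)
    have "P j \<in> ?S (insert a A)" for j
      using P(2,3)[of j] P(4)[of _ _ j] F by blast
    thus "F \<in> dseries.span (?S (insert a A))"
      unfolding P(1) by (intro dseries.span_sum dseries.span_base)
  qed
  hence "dseries.span (?S A) \<subseteq> dseries.span (?S (insert a A))"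
    by (simp add: dseries.span_minimal)
  with insert show ?case by blast
qed

text \<open>Comparing an eigenvalue equation at \<open>n\<close> and at 1 eliminates the eigenvalue
  and shows that \<open>F\<close> divided by its first coefficient is multiplicative. That
  coefficient is nonzero, as otherwise all squares of coefficients would vanish.\<close>

lemma joint_eigenvector_imp_char:
  assumes "m > 0" "F \<in> coprime_supported m" "F \<noteq> 0"
    and eig: "\<And>a. coprime a m \<Longrightarrow> a > 0 \<Longrightarrow> a \<le> m \<Longrightarrow> \<exists>c. translate a F = cscale c F"
  obtains c \<chi> where "dirichlet_char m \<chi>" "F = cscale c (Lser \<chi>)"
proof -
  have H: "F \<in> Hsp m" using assms(2) by (simp add: coprime_supported_def)
  have z: "coeff F n = 0" if "\<not> coprime n m" for n
    using assms(2) that by (simp add: coprime_supported_def)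
  have mult1: "coeff F (a * n) * coeff F 1 = coeff F a * coeff F n" if "a > 0" "n > 0" for a n
  proof (cases "coprime a m")
    case True
    \<comment> \<open>The representative of \<open>a\<close> in \<open>1..m\<close>, the range in
      which eigenvalues are provided.\<close>
    define b where "b = Suc ((a - 1) mod m)"
    have "a = b + (a - 1) div m * m" using that(1) by (simp add: b_def)
    hence ab: "[a = b] (mod m)" by (metis cong_def mod_mult_self1)
    have b: "b > 0" "b \<le> m" using assms(1) by (auto simp: b_def Suc_le_eq)
    have "coprime b m" using True ab cong_imp_coprime by blast
    then obtain c where c: "translate b F = cscale c F" using eig b by blast
    have "coeff F (a * n) = coeff F (b * n)" "coeff F a = coeff F b"
      using ab b that H by (auto intro!: coeff_cong[of _ m] cong_scalar_right)
    moreover have "coeff F (b * k) = c * coeff F k" for k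
      using arg_cong[OF c, of "\<lambda>G. coeff G k"] by simp
    ultimately show ?thesis by (metis mult.assoc mult.commute mult.right_neutral)
  qed (simp add: z)
  define x where "x = coeff F 1"
  have x0: "x \<noteq> 0"
  proof
    assume "x = 0"
    hence "coeff F n * coeff F n = 0" if "n > 0" for n using mult1[OF that that] by (simp add: x_def)
    hence "F = 0" by (intro dseries_eqI) auto
    with assms(3) show False ..
  qed
  \<comment> \<open>The shift by \<open>m\<close> avoids the default coefficient 0 at index 0; for
    \<open>m = 1\<close> the character must take the value 1 there.\<close>
  define \<chi> where "\<chi> n = coeff F (n + m) / x" for n
  have \<chi>: "\<chi> n = coeff F k / x" if "[k = n] (mod m)" "k > 0" for n k
    using coeff_cong[OF H, of k "n + m"] that assms(1) by (simp add: \<chi>_def cong_def)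
  have ch: "\<chi> (a * b) = \<chi> a * \<chi> b" for a b
  proof -
    have "\<chi> (a * b) = coeff F ((a + m) * (b + m)) / x"
      using assms(1) by (intro \<chi> cong_mult) (simp_all add: cong_def)
    thus ?thesis using mult1[of "a + m" "b + m"] assms(1) x0
      by (simp add: \<chi>_def x_def field_simps)
  qed
  have nz: "\<chi> a \<noteq> 0" if "coprime a m" for a
  proof -
    obtain u where u: "[a * u = 1] (mod m)"
      using cong_solve_coprime_nat[OF \<open>coprime a m\<close>] by auto
    have "\<chi> (a * u) = coeff F 1 / x" using u by (intro \<chi>) (auto intro: cong_sym)
    hence "\<chi> a * \<chi> u = 1" using ch x0 by (simp add: x_def)
    thus ?thesis by auto
  qed
  have "dirichlet_char m \<chi>"
    unfolding dirichlet_char_def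
  proof (intro conjI allI)
    show "\<chi> 1 = 1" using \<chi>[of 1 1] x0 by (simp add: x_def)
    show "\<chi> (a + m) = \<chi> a" for a
      using \<chi>[of "a + m" a] \<chi>[of "a + m" "a + m"] assms(1) by (simp add: cong_def)
    show "\<chi> a = 0 \<longleftrightarrow> \<not> coprime a m" for a
    proof -
      have "coprime (a + m) m \<longleftrightarrow> coprime a m" by (simp add: coprime_iff_gcd_eq_1)
      thus ?thesis using nz[of a] z[of "a + m"] by (auto simp: \<chi>_def)
    qed
  qed (use ch assms(1) in auto)
  moreover have "F = cscale x (Lser \<chi>)"
    using x0 \<chi>[OF cong_refl] by (intro dseries_eqI) (simp add: Lser_def coeff_dseries_of)
  ultimately show ?thesis using that by blast
qed

lemma coprime_supported_span_chars:
  assumes "m > 0"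
  shows "coprime_supported m \<subseteq> dseries.span (Lser ` {\<chi>. dirichlet_char m \<chi>})"
proof -
  \<comment> \<open>Representatives of the units suffice, and they form a finite set of positive
    integers, as the diagonalization requires.\<close>
  let ?A = "{a \<in> {1..m}. coprime a m}"
  have "F \<in> dseries.span (Lser ` {\<chi>. dirichlet_char m \<chi>})"
    if F: "F \<in> coprime_supported m" "\<forall>a\<in>?A. \<exists>c. translate a F = cscale c F" for F
  proof (cases "F = 0")
    case False
    have "\<exists>c. translate a F = cscale c F" if "coprime a m" "a > 0" "a \<le> m" for a
      using F(2) that by auto
    then obtain c \<chi> where "dirichlet_char m \<chi>" "F = cscale c (Lser \<chi>)"
      using joint_eigenvector_imp_char[OF assms F(1) False] by metis
    thus ?thesis by (auto intro: dseries.span_scale dseries.span_base)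
  qed (simp add: dseries.span_zero)
  hence "dseries.span {F \<in> coprime_supported m. \<forall>a\<in>?A. \<exists>c. translate a F = cscale c F}
      \<subseteq> dseries.span (Lser ` {\<chi>. dirichlet_char m \<chi>})"
    by (intro dseries.span_minimal) auto
  thus ?thesis
    using coprime_supported_span_eigen[of ?A m] assms by fastforce
qed

section \<open>Decomposition by greatest common divisors\<close>

lemma divide_pow_add: "divide_pow (F + G) d = divide_pow F d + divide_pow G d"
  by (rule dseries_eqI) (simp add: coeff_divide_pow)

lemma divide_pow_cscale: "divide_pow (cscale c F) d = cscale c (divide_pow F d)"
  by (rule dseries_eqI) (simp add: coeff_divide_pow)

lemma divide_pow_zero: "divide_pow 0 d = 0"
  by (rule dseries_eqI) (simp add: coeff_divide_pow)

lemma divide_pow_sum: "divide_pow (\<Sum>i\<in>A. F i) d = (\<Sum>i\<in>A. divide_pow (F i) d)"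
  by (rule dseries_eqI) (simp add: coeff_divide_pow)

lemma divide_pow_divide_pow: "divide_pow (divide_pow F e) d = divide_pow F (d * e)"
proof (rule dseries_eqI)
  fix n :: nat assume "n > 0"
  show "coeff (divide_pow (divide_pow F e) d) n = coeff (divide_pow F (d * e)) n"
  proof (cases "d dvd n")
    case True
    then obtain k where "n = d * k" ..
    thus ?thesis using \<open>n > 0\<close> by (simp add: coeff_divide_pow)
  next
    case False
    hence "\<not> d * e dvd n" by (auto dest: dvd_mult_left)
    with False show ?thesis by (simp add: coeff_divide_pow)
  qed
qed

lemma divide_pow_in_span:
  assumes "F \<in> dseries.span S"
  shows "divide_pow F d \<in> dseries.span ((\<lambda>G. divide_pow G d) ` S)"
proof -
  let ?T = "{G. divide_pow G d \<in> dseries.span ((\<lambda>G. divide_pow G d) ` S)}"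
  have "dseries.span S \<subseteq> ?T"
    by (intro dseries.span_minimal)
      (auto simp: dseries.subspace_def divide_pow_add divide_pow_cscale divide_pow_zero
        intro: dseries.span_add dseries.span_scale dseries.span_zero dseries.span_base)
  thus ?thesis using assms by blast
qed

lemma div_dvd_self:
  fixes d q :: nat
  assumes "d dvd q"
  shows "q div d dvd q"
  using assms by (metis dvd_mult_div_cancel dvd_triv_right)

lemma gcd_eq_iff_coprime_div:
  fixes d n q :: nat
  assumes "d dvd q" "q > 0"
  shows "gcd n q = d \<longleftrightarrow> d dvd n \<and> coprime (n div d) (q div d)"
proof -
  have "d > 0" using assms by (auto intro: Nat.gr0I)
  show ?thesis
  proof (cases "d dvd n")
    case True
    hence "gcd n q = d * gcd (n div d) (q div d)"
      using assms by (metis dvd_mult_div_cancel gcd_mult_distrib_nat)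
    thus ?thesis using \<open>d > 0\<close> True by (simp add: coprime_iff_gcd_eq_1)
  qed (metis gcd_dvd1)
qed

text \<open>The summand for \<open>d\<close> is the restriction of \<open>F\<close> to the indices
  with \<open>gcd n q = d\<close>, and these sets partition the positive integers.\<close>

lemma gcd_decomposition:
  assumes "q > 0"
  shows "F = (\<Sum>d | d dvd q. divide_pow
    (dseries_of (\<lambda>n. if coprime n (q div d) then coeff F (d * n) else 0)) d)"
    (is "_ = (\<Sum>d | d dvd q. ?G d)")
proof (rule dseries_eqI)
  fix n :: nat assume "n > 0"
  have "coeff (?G d) n = (if d = gcd n q then coeff F n else 0)" if "d dvd q" for d
    using gcd_eq_iff_coprime_div[OF that assms, of n] \<open>n > 0\<close>
    by (auto simp: coeff_divide_pow coeff_dseries_of dvd_div_eq_0_iff)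
  hence "coeff (\<Sum>d | d dvd q. ?G d) n = (\<Sum>d | d dvd q. if d = gcd n q then coeff F n else 0)"
    by simp
  also have "\<dots> = coeff F n" using assms by (simp add: sum.delta' finite_divisors_nat)
  finally show "coeff F n = coeff (\<Sum>d | d dvd q. ?G d) n" by simp
qed

text \<open>In the part with gcd \<open>e\<close> the coefficient \<open>\<psi> (e * n)\<close>
  factors, and \<open>\<psi> e\<close> comes out as a scalar.\<close>

lemma Lser_gcd_decomposition:
  assumes "dirichlet_char f \<psi>" "m > 0"
  shows "Lser \<psi> = (\<Sum>e | e dvd m. cscale (\<psi> e) (divide_pow (Lser (extend_char \<psi> (m div e))) e))"
proof -
  have "dseries_of (\<lambda>n. if coprime n (m div e) then coeff (Lser \<psi>) (e * n) else 0) =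
      cscale (\<psi> e) (Lser (extend_char \<psi> (m div e)))" if "e dvd m" for e
  proof -
    have "e > 0" using that assms(2) by (auto intro: Nat.gr0I)
    thus ?thesis using dirichlet_char_mult[OF assms(1)]
      by (intro dseries_eqI) (simp add: coeff_dseries_of Lser_def extend_char_def)
  qed
  thus ?thesis
    by (subst gcd_decomposition[OF assms(2)]) (simp add: divide_pow_cscale)
qed

section \<open>The orthogonal basis\<close>

definition char_index :: "nat \<Rightarrow> (nat \<times> (nat \<Rightarrow> complex)) set" where
  "char_index q = {(d, \<chi>). d dvd q \<and> dirichlet_char (q div d) \<chi>}"

definition char_series :: "nat \<times> (nat \<Rightarrow> complex) \<Rightarrow> dseries" where
  "char_series = (\<lambda>(d, \<chi>). divide_pow (Lser \<chi>) d)"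

lemma char_series_in_Hsp: "q > 0 \<Longrightarrow> i \<in> char_index q \<Longrightarrow> char_series i \<in> Hsp q"
  by (auto simp: char_index_def char_series_def intro: divide_pow_Lser_in_Hsp)

lemma char_series_nonzero:
  assumes "q > 0" "i \<in> char_index q"
  shows "char_series i \<noteq> 0"
proof -
  obtain d \<chi> where i: "i = (d, \<chi>)" "d dvd q" "dirichlet_char (q div d) \<chi>"
    using assms(2) by (auto simp: char_index_def)
  have "d > 0" using i assms by (auto intro: Nat.gr0I)
  hence "coeff (char_series i) d = 1" using i
    by (simp add: char_series_def coeff_divide_pow Lser_def coeff_dseries_of dirichlet_char_1)
  thus ?thesis by auto
qed

lemma Hsp_subset_span_char_series:
  assumes "q > 0"
  shows "Hsp q \<subseteq> dseries.span (char_series ` char_index q)"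
proof
  fix F assume F: "F \<in> Hsp q"
  let ?G = "\<lambda>d. dseries_of (\<lambda>n. if coprime n (q div d) then coeff F (d * n) else 0)"
  have "divide_pow (?G d) d \<in> dseries.span (char_series ` char_index q)" if d: "d dvd q" for d
  proof -
    have pos: "d > 0" "q div d > 0" using d assms by (auto intro: Nat.gr0I)
    have qd: "d * (q div d) = q" using d by simp
    \<comment> \<open>A step of \<open>q div d\<close> in the rescaled index is a full period
      \<open>q\<close> of \<open>F\<close>.\<close>
    have "coeff F (d * (n + q div d)) = coeff F (d * n)" if "n \<ge> 1" for n
      using F pos that by (intro coeff_cong[OF F]) (auto simp: cong_def distrib_left qd)
    moreover have "coprime (n + q div d) (q div d) \<longleftrightarrow> coprime n (q div d)" for n
      by (simp add: coprime_iff_gcd_eq_1)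
    ultimately have "?G d \<in> coprime_supported (q div d)"
      by (auto simp: coprime_supported_def Hsp_def coeff_dseries_of)
    hence "?G d \<in> dseries.span (Lser ` {\<chi>. dirichlet_char (q div d) \<chi>})"
      using coprime_supported_span_chars[OF pos(2)] by blast
    hence "divide_pow (?G d) d \<in>
        dseries.span ((\<lambda>G. divide_pow G d) ` Lser ` {\<chi>. dirichlet_char (q div d) \<chi>})"
      by (rule divide_pow_in_span)
    moreover have "(\<lambda>G. divide_pow G d) ` Lser ` {\<chi>. dirichlet_char (q div d) \<chi>}
        \<subseteq> char_series ` char_index q"
      using d by (force simp: char_index_def char_series_def)
    ultimately show ?thesis using dseries.span_mono by blast
  qed
  thus "F \<in> dseries.span (char_series ` char_index q)"
    by (subst gcd_decomposition[OF assms]) (auto intro: dseries.span_sum)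
qed

section \<open>Orthogonality of the character series\<close>

lemma coprime_pos_lift:
  assumes "q > 0" "coprime a q"
  obtains b :: nat where "b > 0" "coprime b q" "[b = a] (mod q)"
  using that[of "a + q"] assms by (simp add: cong_def coprime_iff_gcd_eq_1)

text \<open>Both characters depend only on the class modulo \<open>q\<close>, so a place where they
  differ can be made positive, as the eigenvalue equations require. This matters for
  \<open>a = 0\<close>, which is prime to \<open>q = 1\<close>.\<close>

lemma dirichlet_char_differ:
  assumes "dirichlet_char f \<psi>" "dirichlet_char g \<phi>" "f dvd q" "g dvd q" "q > 0"
    and "\<not> (\<forall>a. coprime a q \<longrightarrow> \<psi> a = \<phi> a)"
  obtains a where "a > 0" "coprime a q" "\<psi> a \<noteq> \<phi> a"
proof -
  obtain a where a: "coprime a q" "\<psi> a \<noteq> \<phi> a" using assms(6) by blast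
  obtain b where b: "b > 0" "coprime b q" "[b = a] (mod q)"
    using coprime_pos_lift[OF assms(5) a(1)] .
  have "\<psi> b = \<psi> a" "\<phi> b = \<phi> a"
    using b(3) assms(1-4) by (metis cong_dvd_modulus_nat dirichlet_char_cong)+
  thus ?thesis using that a b by metis
qed

lemma hprod_char_series_eq_0:
  assumes "q > 0" "i \<in> char_index q" "j \<in> char_index q" "i \<noteq> j"
  shows "hprod q (char_series i) (char_series j) = 0"
proof -
  obtain d \<chi> where i: "i = (d, \<chi>)" "d dvd q" "dirichlet_char (q div d) \<chi>"
    using assms(2) by (auto simp: char_index_def)
  obtain e \<phi> where j: "j = (e, \<phi>)" "e dvd q" "dirichlet_char (q div e) \<phi>"
    using assms(3) by (auto simp: char_index_def)
  show ?thesis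
  proof (cases "d = e")
    case True
    hence "\<chi> \<noteq> \<phi>" using i j assms by simp
    hence ne: "\<not> (\<forall>a. coprime a q \<longrightarrow> \<chi> a = \<phi> a)"
      using dirichlet_char_eqI[OF i(3), of \<phi> q] j(3) True assms(1) by auto
    obtain a where a: "a > 0" "coprime a q" "\<chi> a \<noteq> \<phi> a"
      using dirichlet_char_differ[OF i(3) j(3) _ _ assms(1) ne] i(2) j(2)
      by (metis div_dvd_self)
    have cop: "coprime a d" "coprime a e" "coprime a (q div e)"
      using a(2) i(2) j(2) by (auto intro: coprime_divisors[OF dvd_refl, of _ q] div_dvd_self)
    show ?thesis
    proof (rule hprod_eq_0_if_eigen)
      show "translate a (char_series i) = cscale (\<chi> a) (char_series i)"
        using translate_divide_pow_Lser[OF i(3) cop(1) a(1)] by (simp add: i char_series_def)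
      show "translate a (char_series j) = cscale (\<phi> a) (char_series j)"
        using translate_divide_pow_Lser[OF j(3) cop(2) a(1)] by (simp add: j char_series_def)
    qed (use a assms char_series_in_Hsp norm_dirichlet_char[OF j(3) cop(3)] in auto)
  next
    case False
    \<comment> \<open>The supports are contained in level sets of \<open>gcd n q\<close>, so for
      \<open>d\<close> and \<open>e\<close> distinct each product of coefficients vanishes.\<close>
    have s: "gcd n q = d'" if "coeff (char_series (d', \<chi>')) n \<noteq> 0"
      "d' dvd q" "dirichlet_char (q div d') \<chi>'" for n d' \<chi>'
      using that gcd_eq_iff_coprime_div[OF that(2) assms(1), of n] dirichlet_char_eq_0_iff[OF that(3)]
      by (auto simp: char_series_def coeff_divide_pow Lser_def coeff_dseries_of split: if_splits)
    have "coeff (char_series i) n * cnj (coeff (char_series j) n) = 0" for n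
      using s[of d \<chi> n] s[of e \<phi> n] False i j by auto
    thus ?thesis by (simp only: hprod_def sum.neutral_const)
  qed
qed

section \<open>Linear independence and finiteness of the index set\<close>

lemma hprod_sum_left: "hprod q (\<Sum>i\<in>A. F i) G = (\<Sum>i\<in>A. hprod q (F i) G)"
proof (induction A rule: infinite_finite_induct)
  case (insert x A)
  thus ?case by (simp add: hprod_add_left)
qed (simp_all add: hprod_def)

text \<open>Pairing a vanishing combination with \<open>v\<close> isolates
  \<open>u v * hprod q v v\<close>, and the product is definite on \<open>Hsp q\<close>.\<close>

lemma independent_if_orthogonal:
  assumes "q > 0" "B \<subseteq> Hsp q" "0 \<notin> B"
    and "\<And>F G. F \<in> B \<Longrightarrow> G \<in> B \<Longrightarrow> F \<noteq> G \<Longrightarrow> hprod q F G = 0"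
  shows "\<not> dseries.dependent B"
proof
  assume "dseries.dependent B"
  then obtain S u v where S: "finite S" "S \<subseteq> B" "(\<Sum>F\<in>S. cscale (u F) F) = 0"
    and v: "v \<in> S" "u v \<noteq> 0"
    unfolding dseries.dependent_explicit by blast
  have "0 = hprod q (\<Sum>F\<in>S. cscale (u F) F) v" by (simp only: S(3)) (simp add: hprod_def)
  also have "\<dots> = (\<Sum>F\<in>S. if F = v then u v * hprod q v v else 0)"
    unfolding hprod_sum_left hprod_cscale_left
    using assms(4) S(2) v(1) by (intro sum.cong) auto
  also have "\<dots> = u v * hprod q v v" using S(1) v(1) by simp
  finally have "hprod q v v = 0" using v(2) by simp
  thus False using hprod_self_eq_0_iff[OF assms(1)] assms(2,3) S(2) v(1) by auto
qed

lemma orthogonal_basis_char_series: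
  assumes "q > 0"
  shows "orthogonal_basis q (char_index q) char_series"
proof -
  have sub: "char_series ` char_index q \<subseteq> Hsp q"
    using char_series_in_Hsp[OF assms] by blast
  moreover have "inj_on char_series (char_index q)"
  proof (rule inj_onI, rule ccontr)
    fix i j assume ij: "i \<in> char_index q" "j \<in> char_index q" "char_series i = char_series j" "i \<noteq> j"
    hence "hprod q (char_series i) (char_series i) = 0"
      using hprod_char_series_eq_0[OF assms ij(1,2,4)] by simp
    thus False
      using ij assms hprod_self_eq_0_iff char_series_in_Hsp char_series_nonzero by metis
  qed
  moreover have "\<not> dseries.dependent (char_series ` char_index q)"
    using sub char_series_nonzero[OF assms] hprod_char_series_eq_0[OF assms]
    by (intro independent_if_orthogonal[OF assms sub]) (auto, metis)
  moreover have "dseries.span (char_series ` char_index q) = Hsp q"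
    using Hsp_subset_span_char_series[OF assms] dseries.span_minimal[OF sub subspace_Hsp] by blast
  ultimately show ?thesis
    using hprod_char_series_eq_0[OF assms] by (auto simp: orthogonal_basis_def)
qed

text \<open>An independent family in a space of dimension \<open>q\<close> is finite, and
  injectivity carries this over to the indices.\<close>

lemma finite_char_index:
  assumes "q > 0"
  shows "finite (char_index q)"
proof -
  obtain B where "B \<subseteq> Hsp q" "Hsp q \<subseteq> dseries.span B" "card B = q"
    using dseries.basis_exists[of "Hsp q"] dim_Hsp[OF assms] by metis
  \<comment> \<open>An infinite set has cardinality 0 by convention, which
    \<open>card B = q > 0\<close> excludes.\<close>
  moreover from this have "finite B" using assms card_gt_0_iff by metis
  moreover have "\<not> dseries.dependent (char_series ` char_index q)"
    "char_series ` char_index q \<subseteq> Hsp q" "inj_on char_series (char_index q)"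
    using orthogonal_basis_char_series[OF assms] by (auto simp: orthogonal_basis_def)
  ultimately show ?thesis
    using dseries.independent_span_bound[of B "char_series ` char_index q"] finite_imageD by blast
qed

section \<open>The orthogonal direct sum\<close>

text \<open>Existence: the sums of components form a subspace containing every \<open>E i\<close>,
  hence the span. Uniqueness: orthogonality and definiteness of the product.\<close>

lemma orthogonal_direct_sumI:
  assumes "q > 0" "finite I"
    and sub: "\<And>i. i \<in> I \<Longrightarrow> dseries.subspace (E i) \<and> E i \<subseteq> Hsp q"
    and orth: "\<And>i j F G. i \<in> I \<Longrightarrow> j \<in> I \<Longrightarrow> i \<noteq> j \<Longrightarrow> F \<in> E i \<Longrightarrow> G \<in> E j \<Longrightarrow> hprod q F G = 0"
    and span: "Hsp q \<subseteq> dseries.span (\<Union>i\<in>I. E i)"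
  shows "orthogonal_direct_sum q I E"
proof -
  let ?S = "{\<Sum>i\<in>I. v i | v. v \<in> (\<Pi>\<^sub>E i\<in>I. E i)}"
  \<comment> \<open>Restricting \<open>v\<close> to \<open>I\<close> meets the extensionality
    demanded by the dependent product without changing the sum.\<close>
  have S: "(\<Sum>i\<in>I. v i) \<in> ?S" if "\<And>i. i \<in> I \<Longrightarrow> v i \<in> E i" for v
    using that by (auto intro!: exI[of _ "restrict v I"])
  have "dseries.subspace ?S"
  proof (rule dseries.subspaceI)
    show "0 \<in> ?S" using S[of "\<lambda>_. 0"] sub dseries.subspace_0 by auto
  next
    fix F G assume "F \<in> ?S" "G \<in> ?S"
    then obtain v w where "F = (\<Sum>i\<in>I. v i)" "G = (\<Sum>i\<in>I. w i)"
      "v \<in> (\<Pi>\<^sub>E i\<in>I. E i)" "w \<in> (\<Pi>\<^sub>E i\<in>I. E i)" by blast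
    thus "F + G \<in> ?S" using S[of "\<lambda>i. v i + w i"] sub
      by (simp add: sum.distrib dseries.subspace_add PiE_mem)
  next
    fix c F assume "F \<in> ?S"
    then obtain v where "F = (\<Sum>i\<in>I. v i)" "v \<in> (\<Pi>\<^sub>E i\<in>I. E i)" by blast
    thus "cscale c F \<in> ?S" using S[of "\<lambda>i. cscale c (v i)"] sub
      by (simp add: dseries.scale_sum_right dseries.subspace_scale PiE_mem)
  qed
  moreover have "(\<Union>i\<in>I. E i) \<subseteq> ?S"
  proof
    fix F assume "F \<in> (\<Union>i\<in>I. E i)"
    then obtain i where i: "i \<in> I" "F \<in> E i" by blast
    have "(\<Sum>j\<in>I. if j = i then F else 0) \<in> ?S"
      using i sub dseries.subspace_0 by (intro S) auto
    thus "F \<in> ?S" using i assms(2) by simp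
  qed
  ultimately have "Hsp q \<subseteq> ?S" using span dseries.span_minimal by blast
  hence ex: "\<exists>v. v \<in> (\<Pi>\<^sub>E i\<in>I. E i) \<and> F = (\<Sum>i\<in>I. v i)" if "F \<in> Hsp q" for F
    using that by blast
  have uniq: "v = w" if v: "v \<in> (\<Pi>\<^sub>E i\<in>I. E i)" and w: "w \<in> (\<Pi>\<^sub>E i\<in>I. E i)"
    and eq: "(\<Sum>i\<in>I. v i) = (\<Sum>i\<in>I. w i)" for v w
  proof (rule PiE_ext[OF v w])
    fix i assume i: "i \<in> I"
    have d: "v j - w j \<in> E j" if "j \<in> I" for j
      using v w sub that by (simp add: dseries.subspace_diff PiE_mem)
    \<comment> \<open>Pairing the vanishing sum of differences with the \<open>i\<close>-th
      difference leaves only its own squared norm.\<close>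
    have "0 = hprod q (\<Sum>j\<in>I. v j - w j) (v i - w i)"
      by (simp add: sum_subtractf eq) (simp add: hprod_def)
    also have "\<dots> = (\<Sum>j\<in>I. if j = i then hprod q (v i - w i) (v i - w i) else 0)"
      unfolding hprod_sum_left using i d orth by (intro sum.cong) auto
    also have "\<dots> = hprod q (v i - w i) (v i - w i)" using i assms(2) by simp
    finally have "v i - w i = 0"
      using hprod_self_eq_0_iff[OF assms(1)] d[OF i] sub[OF i] by auto
    thus "v i = w i" by simp
  qed
  show ?thesis
    unfolding orthogonal_direct_sum_def
  proof (intro conjI ballI impI)
    show "\<exists>!v. v \<in> (\<Pi>\<^sub>E i\<in>I. E i) \<and> F = (\<Sum>i\<in>I. v i)" if "F \<in> Hsp q" for F
      using ex[OF that] uniq by (intro ex_ex1I) auto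
  qed (use assms(2) sub orth in auto)
qed

lemma hprod_span_eq_0:
  assumes "\<And>F G. F \<in> A \<Longrightarrow> G \<in> B \<Longrightarrow> hprod q F G = 0"
    and "F \<in> dseries.span A" "G \<in> dseries.span B"
  shows "hprod q F G = 0"
proof -
  have left: "hprod q F G = 0" if "\<And>F. F \<in> A \<Longrightarrow> hprod q F G = 0" "F \<in> dseries.span A" for A F G
  proof -
    have "dseries.span A \<subseteq> {F. hprod q F G = 0}"
      using that(1) by (intro dseries.span_minimal)
        (auto simp: dseries.subspace_def hprod_add_left hprod_cscale_left, simp add: hprod_def)
    thus ?thesis using that(2) by blast
  qed
  have "hprod q K F = 0" if "K \<in> B" for K
  proof -
    have "hprod q F K = 0" using assms(1) that by (intro left[OF _ assms(2)])
    thus ?thesis using hprod_commute[of q K F] by simp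
  qed
  hence "hprod q G F = 0" by (rule left[OF _ assms(3)])
  thus ?thesis using hprod_commute[of q F G] by simp
qed

section \<open>The subspaces belonging to primitive characters\<close>

lemma Dpr_modulus:
  assumes "q > 0" "(f, \<psi>) \<in> Dpr q"
  shows "primitive_char f \<psi>" "dirichlet_char f \<psi>" "conductor f \<psi> = f" "f dvd q"
  using assms Dpr_iff[OF assms(1), of f \<psi>] by (auto simp: primitive_char_def)

lemma Esp_eq:
  assumes "q > 0" "(f, \<psi>) \<in> Dpr q"
  shows "Esp q (f, \<psi>) = dseries.span {divide_pow (Lser \<psi>) d | d. d dvd q div f}"
  using Dpr_modulus[OF assms] by (simp add: Esp_def)

text \<open>Since \<open>q div (q div f) = f\<close>, sending \<open>(f, \<psi>)\<close> to
  \<open>(q div f, \<psi>)\<close> embeds \<open>Dpr q\<close> into the finite set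
  \<open>char_index q\<close>.\<close>

lemma finite_Dpr:
  assumes "q > 0"
  shows "finite (Dpr q)"
proof (rule inj_on_finite[OF _ _ finite_char_index[OF assms]])
  let ?g = "\<lambda>(f, \<psi> :: nat \<Rightarrow> complex). (q div f, \<psi>)"
  have inv: "q div (q div f) = f \<and> q div f dvd q" if "f dvd q" for f
    using that assms by (auto elim!: dvdE)
  show "inj_on ?g (Dpr q)"
    using Dpr_modulus(4)[OF assms] inv by (intro inj_onI) (clarsimp, metis)
  show "?g ` Dpr q \<subseteq> char_index q"
    using Dpr_modulus[OF assms] inv by (auto simp: char_index_def)
qed

text \<open>Two distinct primitive characters differ at some \<open>a\<close> prime to
  \<open>q\<close>, and the generators of the two spaces are eigenvectors of
  \<open>translate a\<close> with these different eigenvalues.\<close>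

lemma hprod_Esp_eq_0:
  assumes "q > 0" "i \<in> Dpr q" "j \<in> Dpr q" "i \<noteq> j" "F \<in> Esp q i" "G \<in> Esp q j"
  shows "hprod q F G = 0"
proof -
  obtain f \<psi> g \<phi> where ij: "i = (f, \<psi>)" "j = (g, \<phi>)" by (cases i, cases j)
  note i = Dpr_modulus[OF assms(1) assms(2)[unfolded ij]]
  note j = Dpr_modulus[OF assms(1) assms(3)[unfolded ij]]
  have ne: "\<not> (\<forall>a. coprime a q \<longrightarrow> \<psi> a = \<phi> a)"
    using primitive_char_unique[OF i(1) j(1) i(4) j(4) assms(1)] assms(4) ij by auto
  obtain a where a: "a > 0" "coprime a q" "\<psi> a \<noteq> \<phi> a"
    using dirichlet_char_differ[OF i(2) j(2) i(4) j(4) assms(1) ne] .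
  have cop: "coprime a d" if "d dvd q" for d
    using a(2) that by (auto intro: coprime_divisors[OF dvd_refl])
  have dvd: "d * h dvd q" if "d dvd q div h" "h dvd q" for d h
    using that by (metis dvd_div_mult_self dvd_refl mult_dvd_mono)
  have orth: "hprod q (divide_pow (Lser \<psi>) d) (divide_pow (Lser \<phi>) e) = 0"
    if de: "d dvd q div f" "e dvd q div g" for d e
  proof (rule hprod_eq_0_if_eigen[OF a(2,1) assms(1)])
    note dq = dvd[OF de(1) i(4)] dvd[OF de(2) j(4)]
    show "divide_pow (Lser \<psi>) d \<in> Hsp q" "divide_pow (Lser \<phi>) e \<in> Hsp q"
      using divide_pow_Lser_in_Hsp i(2) j(2) dq assms(1) by auto
    show "translate a (divide_pow (Lser \<psi>) d) = cscale (\<psi> a) (divide_pow (Lser \<psi>) d)"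
      using dq by (intro translate_divide_pow_Lser[OF i(2)] cop a(1)) (auto dest: dvd_mult_left)
    show "translate a (divide_pow (Lser \<phi>) e) = cscale (\<phi> a) (divide_pow (Lser \<phi>) e)"
      using dq by (intro translate_divide_pow_Lser[OF j(2)] cop a(1)) (auto dest: dvd_mult_left)
  qed (use norm_dirichlet_char[OF j(2) cop[OF j(4)]] a(3) in auto)
  show ?thesis
    using assms(2,3,5,6) unfolding ij
    by (simp add: Esp_eq[OF assms(1)]) (rule hprod_span_eq_0, auto simp: orth)
qed

text \<open>
  In the decomposition of \<open>L\<^sub>\<psi>/d\<^sup>s\<close> by greatest common divisors with \<open>q/d\<close>, the term for \<open>e = 1\<close> is the
  series of the character modulo \<open>q/d\<close> induced by \<open>\<psi>\<close>; the other terms have \<open>de > d\<close> in place of \<open>d\<close>.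
  Induction thus replaces the usual Moebius inversion.
\<close>

lemma induced_series_in_span:
  assumes "q > 0" "dirichlet_char f \<psi>" "d * f dvd q"
  shows "divide_pow (Lser (extend_char \<psi> (q div d))) d \<in>
    dseries.span {divide_pow (Lser \<psi>) d | d. d dvd q div f}"
  using assms(3)
proof (induction "q div d" arbitrary: d rule: less_induct)
  case less
  let ?V = "dseries.span {divide_pow (Lser \<psi>) d | d. d dvd q div f}"
  have f0: "f > 0" using assms(2) by (simp add: dirichlet_char_def)
  have d: "d dvd q" using less.prems by (rule dvd_mult_left)
  define m where "m = q div d"
  have q: "q = d * m" using d by (simp add: m_def)
  have pos: "d > 0" "m > 0" using q assms(1) by auto
  have fm: "f dvd m" using less.prems pos by (simp add: q)
  let ?t = "\<lambda>e. cscale (\<psi> e) (divide_pow (Lser (extend_char \<psi> (m div e))) (d * e))"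
  have "divide_pow (Lser \<psi>) d = (\<Sum>e | e dvd m. ?t e)"
    by (subst Lser_gcd_decomposition[OF assms(2) pos(2)])
      (simp add: divide_pow_sum divide_pow_cscale divide_pow_divide_pow)
  also have "\<dots> = ?t 1 + (\<Sum>e\<in>{e. e dvd m} - {1}. ?t e)"
    using pos by (intro sum.remove) (auto simp: finite_divisors_nat)
  finally have "?t 1 = divide_pow (Lser \<psi>) d - (\<Sum>e\<in>{e. e dvd m} - {1}. ?t e)" by simp
  moreover have "divide_pow (Lser \<psi>) d \<in> ?V"
  proof -
    have "f dvd q" using less.prems by (rule dvd_mult_right)
    hence "d dvd q div f" using less.prems f0 by (simp add: dvd_div_iff_mult)
    thus ?thesis by (blast intro: dseries.span_base)
  qed
  moreover have "?t e \<in> ?V" if e: "e \<in> {e. e dvd m} - {1}" for e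
  \<comment> \<open>If \<open>e\<close> is prime to \<open>f\<close>, then \<open>e * f\<close>
    divides \<open>m\<close> because both factors do, and the induction hypothesis applies to
    \<open>d * e\<close>. Otherwise \<open>\<psi> e = 0\<close> removes the term.\<close>
  proof (cases "coprime e f")
    case True
    have "e * f dvd m" using True e fm by (simp add: divides_mult)
    hence "d * e * f dvd q" by (simp add: q mult.assoc)
    moreover have "q div (d * e) = m div e" using pos by (simp add: q)
    moreover have "m div e < q div d"
      using e pos by (cases "e = 0") (auto simp: m_def[symmetric])
    ultimately have "divide_pow (Lser (extend_char \<psi> (m div e))) (d * e) \<in> ?V"
      using less.hyps[of "d * e"] by metis
    thus ?thesis by (rule dseries.span_scale)
  next
    case False
    thus ?thesis using dirichlet_char_eq_0_iff[OF assms(2), of e] by (simp add: dseries.span_zero)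
  qed
  ultimately have "?t 1 \<in> ?V"
    by (metis (mono_tags, lifting) dseries.span_diff dseries.span_sum)
  thus ?case by (simp add: dirichlet_char_1[OF assms(2)] m_def)
qed

lemma char_series_in_Esp:
  assumes "q > 0" "i \<in> char_index q"
  obtains j where "j \<in> Dpr q" "char_series i \<in> Esp q j"
proof -
  obtain d \<chi> where i: "i = (d, \<chi>)" "d dvd q" "dirichlet_char (q div d) \<chi>"
    using assms(2) by (auto simp: char_index_def)
  obtain f \<psi> where f: "primitive_char f \<psi>" "induces f \<psi> (q div d) \<chi>"
    using ex_primitive_inducing[OF i(3)] .
  hence f': "dirichlet_char f \<psi>" "f dvd q div d" "conductor f \<psi> = f"
    by (auto simp: induces_def primitive_char_def)
  have df: "d * f dvd q" using f'(2) i(2) by (metis dvd_mult_div_cancel dvd_refl mult_dvd_mono)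
  hence mem: "(f, \<psi>) \<in> Dpr q" using Dpr_iff[OF assms(1)] f(1) f'(3) by (auto dest: dvd_mult_right)
  have "char_series i \<in> Esp q (f, \<psi>)"
    using induced_series_in_span[OF assms(1) f'(1) df]
    unfolding Esp_eq[OF assms(1) mem] i(1) char_series_def induces_eq_extend_char[OF f(2)] by simp
  with mem that show ?thesis by blast
qed

lemma orthogonal_direct_sum_Esp:
  assumes "q > 0"
  shows "orthogonal_direct_sum q (Dpr q) (Esp q)"
proof (rule orthogonal_direct_sumI[OF assms finite_Dpr[OF assms]])
  fix i assume i: "i \<in> Dpr q"
  obtain f \<psi> where fp: "i = (f, \<psi>)" by (cases i)
  note f = Dpr_modulus[OF assms i[unfolded fp]]
  have "d * f dvd q" if "d dvd q div f" for d
    using that f(4) by (metis dvd_div_mult_self dvd_refl mult_dvd_mono)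
  hence "{divide_pow (Lser \<psi>) d | d. d dvd q div f} \<subseteq> Hsp q"
    using divide_pow_Lser_in_Hsp[OF f(2) _ assms] by auto
  thus "dseries.subspace (Esp q i) \<and> Esp q i \<subseteq> Hsp q"
    using Esp_eq[OF assms i[unfolded fp]] fp
    by (simp add: dseries.span_minimal subspace_Hsp)
next
  \<comment> \<open>Each element of the orthogonal basis lies in one of the spaces, so these span
    \<open>Hsp q\<close> as well.\<close>
  have "char_series ` char_index q \<subseteq> (\<Union>j\<in>Dpr q. Esp q j)"
    using char_series_in_Esp[OF assms] by blast
  thus "Hsp q \<subseteq> dseries.span (\<Union>j\<in>Dpr q. Esp q j)"
    using Hsp_subset_span_char_series[OF assms] dseries.span_mono by blast
qed (rule hprod_Esp_eq_0[OF assms])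

theorem theorem1:
  fixes q :: nat
  assumes "q > 0"
  shows "orthogonal_basis q
           {(d, \<chi>). d dvd q \<and> dirichlet_char (q div d) \<chi>}
           (\<lambda>(d, \<chi>). divide_pow (Lser \<chi>) d)
         \<and> orthogonal_direct_sum q (Dpr q) (Esp q)"
  using orthogonal_basis_char_series[OF assms] orthogonal_direct_sum_Esp[OF assms]
  by (simp add: char_index_def char_series_def)

end
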